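(* Let $N\ge 1$, let $L_0,L_1,M_0,M_1\in\mathbb{C}^{N\times N}$, and let $L(\lambda,\mu)=\mu L_0-\lambda L_1$ be a nonsingular matrix pencil. Let $M(\lambda,\mu)=\mu M_0-\lambda M_1$ be another matrix pencil of the same size such that 1. $M_1L_0=M_0L_1$; 2. the $N\times 2N$ matrix $\begin{bmatrix}M_0 & M_1\end{bmatrix}$ has full row rank $N$. Then $M(\lambda,\mu)$ is strongly equivalent to $L(\lambda,\mu)$. In particular, if $L(\lambda,\mu)$ is a linearization (respectively, a strong linearization) of a matrix polynomial, then $M(\lambda,\mu)$ is a linearization (respectively, a strong linearization) of the same matrix polynomial.
   Context: A homogeneous matrix polynomial $A(\lambda,\mu)=\sum_{i=0}^d A_i\lambda^i\mu^{d-i}$ with $d\ge 1$ and $A_i\in\mathbb{C}^{n\times n}$ is identified with the one-variable matrix polynomial $A(x)=\sum_{i=0}^d A_ix^i$ (put $\lambda=x,\mu=1$). A matrix pencil is the case $d=1$; thus $\mu L_0-\lambda L_1$ corresponds to $L_0-xL_1$. A matrix polynomial is nonsingular (regular) if $\det A(\lambda,\mu)$ is not identically zero. Two pencils $P(\lambda,\mu),Q(\lambda,\mu)$ of size $N\times N$ are strongly equivalent if there are constant nonsingular matrices $E,F\in\mathbb{C}^{N\times N}$ with $E\,P(\lambda,\mu)\,F=Q(\lambda,\mu)$. A pencil $L(x)\in\mathbb{C}^{dn\times dn}[x]$ is a linearization of $A(x)=\sum_{i=0}^dA_ix^i\in\mathbb{C}^{n\times n}[x]$ if there are $E(x),F(x)\in\mathbb{C}^{dn\times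 dn}[x]$ whose determinants are nonzero constants such that $L(x)=E(x)\,\mathrm{diag}(A(x),I_{(d-1)n})\,F(x)$. With $\mathrm{rev}\sum_{i=0}^dM_ix^i:=\sum_{i=0}^dM_{d-i}x^i$ (with $d=1$ for pencils), $L(x)$ is a strong linearization of $A(x)$ if $L(x)$ is a linearization of $A(x)$ and $\mathrm{rev}\,L(x)$ is a linearization of $\mathrm{rev}\,A(x)$. *)

theory Defs
  imports Complex_Main
    "HOL-Computational_Algebra.Polynomial"
    "Jordan_Normal_Form.Determinant"
    "Jordan_Normal_Form.DL_Rank"
begin

text \<open>
  A homogeneous matrix polynomial of grade d is its coefficient sequence A together with d and
  the size n. Only the coefficients with index at most d are meaningful. The grade is explicit
  because leading coefficients may vanish while homogenization and reversal still depend on d.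
\<close>

definition matrix_polynomial :: "nat \<Rightarrow> nat \<Rightarrow> (nat \<Rightarrow> complex mat) \<Rightarrow> bool" where
  "matrix_polynomial n d A \<longleftrightarrow> d \<ge> 1 \<and> (\<forall>i\<le>d. A i \<in> carrier_mat n n)"

definition hom_eval :: "nat \<Rightarrow> nat \<Rightarrow> (nat \<Rightarrow> complex mat) \<Rightarrow> complex \<Rightarrow> complex \<Rightarrow> complex mat" where
  "hom_eval n d A la mu = mat n n (\<lambda>(r, c). \<Sum>i=0..d. A i $$ (r, c) * la ^ i * mu ^ (d - i))"

definition poly_matrix :: "nat \<Rightarrow> nat \<Rightarrow> (nat \<Rightarrow> complex mat) \<Rightarrow> complex poly mat" where
  "poly_matrix n d A = mat n n (\<lambda>(r, c). \<Sum>i=0..d. monom (A i $$ (r, c)) i)"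

definition rev_coeffs :: "nat \<Rightarrow> (nat \<Rightarrow> complex mat) \<Rightarrow> nat \<Rightarrow> complex mat" where
  "rev_coeffs d A = (\<lambda>i. A (d - i))"

definition nonsingular_matpoly :: "nat \<Rightarrow> nat \<Rightarrow> (nat \<Rightarrow> complex mat) \<Rightarrow> bool" where
  "nonsingular_matpoly n d A \<longleftrightarrow> (\<exists>la mu. det (hom_eval n d A la mu) \<noteq> 0)"

text \<open>
  The pencil \<open>\<mu> X - \<lambda> Y\<close>, that is, \<open>X - x Y\<close> in one variable. It has grade 1, so the value at
  indices above 1 is irrelevant.
\<close>

definition pencil :: "complex mat \<Rightarrow> complex mat \<Rightarrow> nat \<Rightarrow> complex mat" where
  "pencil X Y = (\<lambda>i. if i = 0 then X else - Y)"

definition strongly_equivalent ::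
    "nat \<Rightarrow> (nat \<Rightarrow> complex mat) \<Rightarrow> (nat \<Rightarrow> complex mat) \<Rightarrow> bool" where
  "strongly_equivalent N P Q \<longleftrightarrow>
     (\<exists>E\<in>carrier_mat N N. \<exists>F\<in>carrier_mat N N. invertible_mat E \<and> invertible_mat F \<and>
        (\<forall>la mu. E * hom_eval N 1 P la mu * F = hom_eval N 1 Q la mu))"

definition unimodular :: "nat \<Rightarrow> complex poly mat \<Rightarrow> bool" where
  "unimodular m U \<longleftrightarrow> U \<in> carrier_mat m m \<and> (\<exists>c. c \<noteq> 0 \<and> det U = [:c:])"

definition linearization ::
    "nat \<Rightarrow> nat \<Rightarrow> (nat \<Rightarrow> complex mat) \<Rightarrow> (nat \<Rightarrow> complex mat) \<Rightarrow> bool" where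
  "linearization n d L A \<longleftrightarrow>
     matrix_polynomial n d A \<and> matrix_polynomial (d * n) 1 L \<and>
     (\<exists>E F. unimodular (d * n) E \<and> unimodular (d * n) F \<and>
        poly_matrix (d * n) 1 L =
          E * diag_block_mat [poly_matrix n d A, 1\<^sub>m ((d - 1) * n)] * F)"

definition strong_linearization ::
    "nat \<Rightarrow> nat \<Rightarrow> (nat \<Rightarrow> complex mat) \<Rightarrow> (nat \<Rightarrow> complex mat) \<Rightarrow> bool" where
  "strong_linearization n d L A \<longleftrightarrow>
     linearization n d L A \<and> linearization n d (rev_coeffs 1 L) (rev_coeffs d A)"

text \<open>Horizontal concatenation \<open>[X Y]\<close>, as a block matrix whose lower blocks have no rows.\<close>

definition block_row :: "complex mat \<Rightarrow> complex mat \<Rightarrow> complex mat" where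
  "block_row X Y = four_block_mat X Y (0\<^sub>m 0 (dim_col X)) (0\<^sub>m 0 (dim_col Y))"

definition full_row_rank :: "complex mat \<Rightarrow> bool" where
  "full_row_rank A \<longleftrightarrow> vec_space.rank (dim_row A) A = dim_row A"

end

theory Submission
  imports Defs
begin

text \<open>
  Choose \<open>(l, m)\<close> with \<open>S = m L0 - l L1\<close> invertible, and let \<open>U = m M0 - l M1\<close> be the value of the
  other pencil at the same point. The hypothesis \<open>M1 L0 = M0 L1\<close> lets the two pencils trade places:
  \<open>U L0 = m M0 L0 - l M0 L1 = M0 S\<close> and \<open>U L1 = m M1 L0 - l M1 L1 = M1 S\<close>. Hence
  \<open>M\<^sub>i = U L\<^sub>i S\<^sup>-\<^sup>1\<close> for both coefficients. In particular \<open>U\<close> is a left factor of the row \<open>[M0 M1]\<close>,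
  which has a right inverse because its row rank is full; so \<open>U\<close> is invertible too, and the two
  pencils differ by constant invertible factors (\<open>pencil_factorization\<close>).

  Multiplying all coefficients by constant matrices on both sides commutes with evaluation and with
  reversal. Over the polynomials the constant invertible factors are unimodular, so they are absorbed
  by the unimodular factors of a linearization (\<open>linearization_of_equivalent\<close>).
\<close>

section \<open>Invertibility and full row rank\<close>

lemma det_nonzero_inverse:
  fixes A :: "'a::field mat"
  assumes "A \<in> carrier_mat n n" "det A \<noteq> 0"
  obtains B where "B \<in> carrier_mat n n" "A * B = 1\<^sub>m n" "B * A = 1\<^sub>m n"
    "det B \<noteq> 0"
proof -
  from det_non_zero_imp_unit[OF assms]
  obtain B where B: "B \<in> carrier_mat n n" "A * B = 1\<^sub>m n" "B * A = 1\<^sub>m n"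
    unfolding Units_def ring_mat_def by auto
  have "det A * det B = 1"
    using det_mult[OF assms(1) B(1)] B(2) by simp
  then show ?thesis using that B by force
qed

lemma det_nonzero_invertible_mat:
  fixes A :: "'a::field mat"
  assumes A: "A \<in> carrier_mat n n" and "det A \<noteq> 0"
  shows "invertible_mat A"
proof -
  obtain B where "B \<in> carrier_mat n n" "A * B = 1\<^sub>m n" "B * A = 1\<^sub>m n"
    using det_nonzero_inverse[OF assms] .
  then show ?thesis
    using A unfolding invertible_mat_def inverts_mat_def by auto
qed

text \<open>
  A maximal independent set of columns has as many elements as the dimension of the whole space, so
  it spans; the columns of a right inverse are preimages of the unit vectors.
\<close>

lemma full_row_rank_right_inverse:
  assumes A: "A \<in> carrier_mat n k" and rank: "full_row_rank A"
  obtains B where "B \<in> carrier_mat k n" "A * B = 1\<^sub>m n"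
proof -
  interpret vec_space "TYPE(complex)" n .
  have cols: "set (cols A) \<subseteq> carrier_vec n"
    using A cols_dim by blast
  obtain S where S: "maximal S (\<lambda>T. T \<subseteq> set (cols A) \<and> lin_indpt T)"
    using maximal_exists_superset[OF finite_set, of "\<lambda>T. T \<subseteq> set (cols A) \<and> lin_indpt T" "cols A" "{}"]
    by (auto simp: lin_dep_def)
  have sub: "S \<subseteq> set (cols A)" and li: "lin_indpt S"
    using S unfolding maximal_def by auto
  have "card S = dim"
    using rank_card_indpt[OF A S] rank A dim_is_n unfolding full_row_rank_def by simp
  then have "basis S"
    using dim_li_is_basis[OF fin_dim finite_subset[OF sub finite_set] _ li] sub cols by auto
  then have "carrier_vec n = span S" by (simp add: basis_def)
  also have "\<dots> \<subseteq> col_space A"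
    unfolding col_space_def using sub by (rule span_is_monotone)
  finally have "\<exists>x\<in>carrier_vec k. A *\<^sub>v x = y" if "y \<in> carrier_vec n" for y
    using that A by (auto simp: col_space_eq[OF A])
  then have "\<forall>j. \<exists>x\<in>carrier_vec k. A *\<^sub>v x = unit_vec n j" by simp
  then obtain x where x: "\<And>j. x j \<in> carrier_vec k" "\<And>j. A *\<^sub>v x j = unit_vec n j"
    by metis
  define B where "B = mat_of_cols k (map x [0..<n])"
  have B: "B \<in> carrier_mat k n" unfolding B_def by (intro carrier_matI) simp_all
  have "A * B = 1\<^sub>m n"
  proof (rule mat_col_eqI)
    fix j assume "j < dim_col (1\<^sub>m n)"
    then have j: "j < n" by simp
    have "col B j = x j" using j x(1) by (simp add: B_def)
    then show "col (A * B) j = col (1\<^sub>m n) j"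
      using col_mult2[OF A B j] x(2) j by simp
  qed (use A B in auto)
  with B that show thesis by blast
qed

lemma block_row_left_factor:
  assumes "U \<in> carrier_mat n n" "X \<in> carrier_mat n n" "Y \<in> carrier_mat n n"
  shows "block_row (U * X) (U * Y) = U * block_row X Y"
  using assms unfolding block_row_def
  by (intro eq_matI) (auto simp: four_block_mat_def scalar_prod_def)

section \<open>Constant factors on both sides of a matrix polynomial\<close>

lemma index_mult_mat_three:
  assumes "E \<in> carrier_mat n n" "A \<in> carrier_mat n n" "F \<in> carrier_mat n n" "r < n" "c < n"
  shows "(E * A * F) $$ (r, c) = (\<Sum>j<n. \<Sum>k<n. E $$ (r, j) * A $$ (j, k) * F $$ (k, c))"
  using assms by (simp add: scalar_prod_def sum_distrib_left lessThan_atLeast0 mult.assoc)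

text \<open>
  Evaluation and the passage to a polynomial matrix are linear in the coefficients, so in each entry
  the sum over the degree moves inside the two sums of the matrix products.
\<close>

lemma hom_eval_mult:
  assumes E: "E \<in> carrier_mat n n" and F: "F \<in> carrier_mat n n"
    and A: "\<And>i. i \<le> d \<Longrightarrow> A i \<in> carrier_mat n n"
    and B: "\<And>i. i \<le> d \<Longrightarrow> B i = E * A i * F"
  shows "hom_eval n d B la mu = E * hom_eval n d A la mu * F"
proof (rule eq_matI)
  have H: "hom_eval n d A la mu \<in> carrier_mat n n" by (simp add: hom_eval_def)
  fix r c assume "r < dim_row (E * hom_eval n d A la mu * F)"
    "c < dim_col (E * hom_eval n d A la mu * F)"
  then have r: "r < n" and c: "c < n" using E F by auto
  have "hom_eval n d B la mu $$ (r, c)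
      = (\<Sum>i=0..d. \<Sum>j<n. \<Sum>k<n. E $$ (r, j) * A i $$ (j, k) * F $$ (k, c) * la ^ i * mu ^ (d - i))"
    using r c B index_mult_mat_three[OF E A F r c]
    by (simp add: hom_eval_def sum_distrib_right)
  also have "\<dots> = (\<Sum>j<n. \<Sum>i=0..d. \<Sum>k<n.
      E $$ (r, j) * A i $$ (j, k) * F $$ (k, c) * la ^ i * mu ^ (d - i))"
    by (rule sum.swap)
  also have "\<dots> = (\<Sum>j<n. \<Sum>k<n. \<Sum>i=0..d.
      E $$ (r, j) * A i $$ (j, k) * F $$ (k, c) * la ^ i * mu ^ (d - i))"
    by (intro sum.cong refl sum.swap)
  also have "\<dots> = (E * hom_eval n d A la mu * F) $$ (r, c)"
    unfolding index_mult_mat_three[OF E H F r c]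
    by (intro sum.cong refl)
      (simp add: hom_eval_def sum_distrib_left sum_distrib_right mult_ac)
  finally show "hom_eval n d B la mu $$ (r, c) = (E * hom_eval n d A la mu * F) $$ (r, c)" .
qed (use E F in \<open>auto simp: hom_eval_def\<close>)

abbreviation const_poly_mat :: "complex mat \<Rightarrow> complex poly mat" where
  "const_poly_mat \<equiv> map_mat (\<lambda>c. [:c:])"

lemma poly_matrix_mult:
  assumes E: "E \<in> carrier_mat n n" and F: "F \<in> carrier_mat n n"
    and A: "\<And>i. i \<le> d \<Longrightarrow> A i \<in> carrier_mat n n"
    and B: "\<And>i. i \<le> d \<Longrightarrow> B i = E * A i * F"
  shows "poly_matrix n d B = const_poly_mat E * poly_matrix n d A * const_poly_mat F"
proof (rule eq_matI)
  let ?E = "const_poly_mat E" and ?F = "const_poly_mat F" and ?P = "poly_matrix n d A"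
  have E': "?E \<in> carrier_mat n n" and F': "?F \<in> carrier_mat n n" and P: "?P \<in> carrier_mat n n"
    using E F by (auto simp: poly_matrix_def)
  fix r c assume "r < dim_row (?E * ?P * ?F)" "c < dim_col (?E * ?P * ?F)"
  then have r: "r < n" and c: "c < n" using E F by auto
  have "poly_matrix n d B $$ (r, c)
      = (\<Sum>i=0..d. \<Sum>j<n. \<Sum>k<n. monom (E $$ (r, j) * A i $$ (j, k) * F $$ (k, c)) i)"
    using r c B index_mult_mat_three[OF E A F r c]
    by (simp add: poly_matrix_def monom_sum)
  also have "\<dots> = (\<Sum>j<n. \<Sum>i=0..d. \<Sum>k<n. monom (E $$ (r, j) * A i $$ (j, k) * F $$ (k, c)) i)"
    by (rule sum.swap)
  also have "\<dots> = (\<Sum>j<n. \<Sum>k<n. \<Sum>i=0..d. monom (E $$ (r, j) * A i $$ (j, k) * F $$ (k, c)) i)"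
    by (intro sum.cong refl sum.swap)
  also have "\<dots> = (?E * ?P * ?F) $$ (r, c)"
  proof -
    have const: "monom (a * b * c) i = [:a:] * monom b i * [:c:]" for a b c :: complex and i
      by (simp add: smult_monom mult.commute)
    show ?thesis
      \<comment> \<open>The constant polynomials must stay factors, so that distributivity pulls them out of the sum.\<close>
      unfolding index_mult_mat_three[OF E' P F' r c] const
      using E F r c by (intro sum.cong refl)
        (simp add: poly_matrix_def sum_distrib_left sum_distrib_right del: mult_pCons_left mult_pCons_right)
  qed
  finally show "poly_matrix n d B $$ (r, c) = (?E * ?P * ?F) $$ (r, c)" .
qed (use E F in \<open>auto simp: poly_matrix_def\<close>)

section \<open>Linearizations of equivalent pencils\<close>

lemma unimodular_const:
  assumes "E \<in> carrier_mat n n" "det E \<noteq> 0"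
  shows "unimodular n (const_poly_mat E)"
proof -
  interpret comm_ring_hom "\<lambda>c::complex. [:c:]"
    by unfold_locales (auto simp: one_pCons)
  show ?thesis using assms unfolding unimodular_def by (auto simp: hom_det)
qed

lemma unimodular_mult:
  assumes "unimodular n U" "unimodular n V"
  shows "unimodular n (U * V)"
proof -
  obtain a b where a: "a \<noteq> 0" "det U = [:a:]" and b: "b \<noteq> 0" "det V = [:b:]"
    and U: "U \<in> carrier_mat n n" and V: "V \<in> carrier_mat n n"
    using assms unfolding unimodular_def by blast
  have "det (U * V) = [:a * b:]" using det_mult[OF U V] a b by simp
  then show ?thesis using a b U V unfolding unimodular_def by auto
qed

text \<open>
  From \<open>P(x) = E(x) D(x) F(x)\<close>, where \<open>D\<close> is the padded matrix polynomial, the regrouping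
  \<open>Q(x) = (U E(x)) D(x) (F(x) V)\<close> has unimodular outer factors.
\<close>

lemma linearization_of_equivalent:
  assumes lin: "linearization n d P A"
    and U: "U \<in> carrier_mat (d * n) (d * n)" "det U \<noteq> 0"
    and V: "V \<in> carrier_mat (d * n) (d * n)" "det V \<noteq> 0"
    and Q: "\<And>i. i \<le> 1 \<Longrightarrow> Q i = U * P i * V"
  shows "linearization n d Q A"
proof -
  let ?D = "diag_block_mat [poly_matrix n d A, 1\<^sub>m ((d - 1) * n)]"
  let ?U = "const_poly_mat U" and ?V = "const_poly_mat V"
  obtain E F where A: "matrix_polynomial n d A" and P: "matrix_polynomial (d * n) 1 P"
    and E: "unimodular (d * n) E" and F: "unimodular (d * n) F"
    and eq: "poly_matrix (d * n) 1 P = E * ?D * F"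
    using lin unfolding linearization_def by blast
  have Pc: "\<And>i. i \<le> 1 \<Longrightarrow> P i \<in> carrier_mat (d * n) (d * n)"
    using P unfolding matrix_polynomial_def by blast
  have "d * n = n + (d - 1) * n"
    using A by (cases d) (auto simp: matrix_polynomial_def)
  then have D: "?D \<in> carrier_mat (d * n) (d * n)"
    by (intro carrier_matI) (simp_all add: poly_matrix_def Let_def)
  have carr: "E \<in> carrier_mat (d * n) (d * n)" "F \<in> carrier_mat (d * n) (d * n)"
    "?U \<in> carrier_mat (d * n) (d * n)" "?V \<in> carrier_mat (d * n) (d * n)"
    using E F U V unfolding unimodular_def by auto
  have "poly_matrix (d * n) 1 Q = ?U * (E * ?D * F) * ?V"
    using poly_matrix_mult[OF U(1) V(1) Pc Q] eq by simp
  also have "\<dots> = (?U * E) * ?D * (F * ?V)"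
    using carr D by (simp add: assoc_mult_mat[of _ "d * n" "d * n" _ "d * n" _ "d * n"])
  finally have "poly_matrix (d * n) 1 Q = (?U * E) * ?D * (F * ?V)" .
  moreover have "unimodular (d * n) (?U * E)" "unimodular (d * n) (F * ?V)"
    using unimodular_mult unimodular_const U V E F by blast+
  moreover have "matrix_polynomial (d * n) 1 Q"
    using Q Pc U V unfolding matrix_polynomial_def by auto
  ultimately show ?thesis using A unfolding linearization_def by blast
qed

text \<open>Reversal only permutes the coefficients, so the same \<open>U\<close> and \<open>V\<close> relate the reversed pencils.\<close>

lemma strong_linearization_of_equivalent:
  assumes "strong_linearization n d P A"
    and "U \<in> carrier_mat (d * n) (d * n)" "det U \<noteq> 0"
    and "V \<in> carrier_mat (d * n) (d * n)" "det V \<noteq> 0"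
    and "\<And>i. i \<le> 1 \<Longrightarrow> Q i = U * P i * V"
  shows "strong_linearization n d Q A"
proof -
  have "\<And>i. i \<le> 1 \<Longrightarrow> rev_coeffs 1 Q i = U * rev_coeffs 1 P i * V"
    using assms(6) by (simp add: rev_coeffs_def)
  then show ?thesis
    using assms linearization_of_equivalent unfolding strong_linearization_def by metis
qed

section \<open>Pencils that intertwine\<close>

lemma hom_eval_pencil:
  assumes "X \<in> carrier_mat n n" "Y \<in> carrier_mat n n"
  shows "hom_eval n 1 (pencil X Y) la mu = mu \<cdot>\<^sub>m X - la \<cdot>\<^sub>m Y"
  using assms by (intro eq_matI) (auto simp: hom_eval_def pencil_def)

text \<open>
  A nonsingular value of one pencil, together with the value of the other at the same point,
  provides the constant factors.
\<close>

lemma pencil_factorization: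
  assumes L: "L0 \<in> carrier_mat N N" "L1 \<in> carrier_mat N N"
    and M: "M0 \<in> carrier_mat N N" "M1 \<in> carrier_mat N N"
    and reg: "nonsingular_matpoly N 1 (pencil L0 L1)"
    and comm: "M1 * L0 = M0 * L1"
    and rank: "full_row_rank (block_row M0 M1)"
  obtains U V where "U \<in> carrier_mat N N" "V \<in> carrier_mat N N" "det U \<noteq> 0" "det V \<noteq> 0"
    "\<And>i. pencil M0 M1 i = U * pencil L0 L1 i * V"
proof -
  obtain l m where det: "det (m \<cdot>\<^sub>m L0 - l \<cdot>\<^sub>m L1) \<noteq> 0"
    using reg hom_eval_pencil[OF L] unfolding nonsingular_matpoly_def by metis
  define S where "S = m \<cdot>\<^sub>m L0 - l \<cdot>\<^sub>m L1"
  define U where "U = m \<cdot>\<^sub>m M0 - l \<cdot>\<^sub>m M1"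
  have S: "S \<in> carrier_mat N N" and U: "U \<in> carrier_mat N N"
    using L M by (auto simp: S_def U_def)
  obtain V where V: "V \<in> carrier_mat N N" "S * V = 1\<^sub>m N" "det V \<noteq> 0"
    using det_nonzero_inverse[OF S] det S_def by metis
  have expand: "U * X = m \<cdot>\<^sub>m (M0 * X) - l \<cdot>\<^sub>m (M1 * X)"
      "Y * S = m \<cdot>\<^sub>m (Y * L0) - l \<cdot>\<^sub>m (Y * L1)"
    if "X \<in> carrier_mat N N" "Y \<in> carrier_mat N N" for X Y
    unfolding U_def S_def
    using minus_mult_distrib_mat[OF smult_carrier_mat[OF M(1)] smult_carrier_mat[OF M(2)] that(1), of m l]
      mult_minus_distrib_mat[OF that(2) smult_carrier_mat[OF L(1)] smult_carrier_mat[OF L(2)], of m l]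
      mult_smult_assoc_mat[OF M(1) that(1), of m] mult_smult_assoc_mat[OF M(2) that(1), of l]
      mult_smult_distrib[OF that(2) L(1), of m] mult_smult_distrib[OF that(2) L(2), of l]
    by (simp_all only:)
  have "U * L0 = M0 * S" "U * L1 = M1 * S"
    using expand[OF L(1) M(1)] expand[OF L(2) M(2)] comm by simp_all
  then have "U * L0 * V = M0" "U * L1 * V = M1"
    using assoc_mult_mat[OF M(1) S V(1)] assoc_mult_mat[OF M(2) S V(1)] V(2) M by simp_all
  then have M_eq: "M0 = U * (L0 * V)" "M1 = U * (L1 * V)"
    using assoc_mult_mat[OF U L(1) V(1)] assoc_mult_mat[OF U L(2) V(1)] by simp_all
  have row: "block_row X Y \<in> carrier_mat N (N + N)"
    if "X \<in> carrier_mat N N" "Y \<in> carrier_mat N N" for X Y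
    using that by (intro carrier_matI) (auto simp: block_row_def)
  obtain B where B: "B \<in> carrier_mat (N + N) N" "block_row M0 M1 * B = 1\<^sub>m N"
    using full_row_rank_right_inverse[OF row[OF M] rank] .
  let ?R = "block_row (L0 * V) (L1 * V)"
  have R: "?R \<in> carrier_mat N (N + N)"
    using row L V by simp
  have "U * ?R * B = 1\<^sub>m N"
    using B(2) M_eq block_row_left_factor[OF U, of "L0 * V" "L1 * V"] L V by simp
  \<comment> \<open>The right inverse of the row yields one of its left factor \<open>U\<close>.\<close>
  then have "U * (?R * B) = 1\<^sub>m N"
    using assoc_mult_mat[OF U R B(1)] by simp
  then have "det U * det (?R * B) = 1"
    using det_mult[OF U, of "?R * B"] R B(1) by simp
  then have "det U \<noteq> 0" by auto
  moreover have "pencil M0 M1 i = U * pencil L0 L1 i * V" for i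
    using M_eq U V L by (simp add: pencil_def assoc_mult_mat[of _ N N _ N _ N])
  ultimately show thesis using that U V by blast
qed

theorem theorem5:
  fixes N :: nat and L0 L1 M0 M1 :: "complex mat"
  assumes "N \<ge> 1"
    and "L0 \<in> carrier_mat N N" and "L1 \<in> carrier_mat N N"
    and "M0 \<in> carrier_mat N N" and "M1 \<in> carrier_mat N N"
    and "nonsingular_matpoly N 1 (pencil L0 L1)"
    and "M1 * L0 = M0 * L1"
    and "full_row_rank (block_row M0 M1)"
  shows "strongly_equivalent N (pencil M0 M1) (pencil L0 L1) \<and>
    (\<forall>n d A. linearization n d (pencil L0 L1) A \<longrightarrow> linearization n d (pencil M0 M1) A) \<and>
    (\<forall>n d A. strong_linearization n d (pencil L0 L1) A \<longrightarrow>
       strong_linearization n d (pencil M0 M1) A)"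
proof -
  obtain U V where U: "U \<in> carrier_mat N N" "det U \<noteq> 0" and V: "V \<in> carrier_mat N N" "det V \<noteq> 0"
    and M_eq: "\<And>i. pencil M0 M1 i = U * pencil L0 L1 i * V"
    using pencil_factorization assms by metis
  have L: "pencil L0 L1 i \<in> carrier_mat N N" for i
    using assms by (simp add: pencil_def)
  obtain U' where U': "U' \<in> carrier_mat N N" "U' * U = 1\<^sub>m N" "det U' \<noteq> 0"
    using det_nonzero_inverse[OF U] .
  obtain V' where V': "V' \<in> carrier_mat N N" "V * V' = 1\<^sub>m N" "det V' \<noteq> 0"
    using det_nonzero_inverse[OF V] .
  have "U' * hom_eval N 1 (pencil M0 M1) la mu * V' = hom_eval N 1 (pencil L0 L1) la mu" for la mu
  proof -
    let ?H = "hom_eval N 1 (pencil L0 L1) la mu"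
    have H: "?H \<in> carrier_mat N N" by (simp add: hom_eval_def)
    have "U' * (U * ?H * V) * V' = U' * (U * (?H * (V * V')))"
      using U U' V V' H by (simp add: assoc_mult_mat[of _ N N _ N _ N])
    also have "\<dots> = (U' * U) * ?H"
      using V' H assoc_mult_mat[OF U'(1) U(1) H] by simp
    also have "\<dots> = ?H" using U' H by simp
    finally show ?thesis
      using hom_eval_mult[OF U(1) V(1) L M_eq] by simp
  qed
  then have "strongly_equivalent N (pencil M0 M1) (pencil L0 L1)"
    unfolding strongly_equivalent_def
    using U' V' det_nonzero_invertible_mat by blast
  \<comment> \<open>A linearization fixes the size of its pencil, so the factors have the size it requires.\<close>
  moreover have size: "d * n = N" if "linearization n d (pencil L0 L1) A" for n d A
    using that L[of 0] unfolding linearization_def matrix_polynomial_def carrier_mat_def by auto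
  have "linearization n d (pencil M0 M1) A" if lin: "linearization n d (pencil L0 L1) A" for n d A
    using linearization_of_equivalent[OF lin] U V M_eq unfolding size[OF lin] by blast
  moreover have "strong_linearization n d (pencil M0 M1) A"
    if lin: "strong_linearization n d (pencil L0 L1) A" for n d A
  proof -
    have "d * n = N" using lin size unfolding strong_linearization_def by blast
    then show ?thesis
      using strong_linearization_of_equivalent[OF lin] U V M_eq by blast
  qed
  ultimately show ?thesis by blast
qed

end
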